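(* Let $\tau>0$, $\sigma>1$, and let $U$ and $V$ be open sets in $\mathbf{R}$ and $\mathbf{R}^d$, respectively. If $f\in \mathcal{E}_{\tau,\sigma}(U)$ and $g\in \mathcal{E}_{\tau,\sigma}(V)$ is such that $g: V\to U$, then $f\circ g\in \mathcal{E}_{\tau,\sigma}(V)$. Here $\mathcal{E}_{\tau,\sigma}$ stands for either $\mathcal{E}_{\{\tau,\sigma\}}$ (at all three occurrences) or $\mathcal{E}_{(\tau,\sigma)}$ (at all three occurrences); the assertion holds in both cases.
   Context: $\mathbf{N}$ denotes the nonnegative integers. For $\tau>0$, $\sigma>1$ put $M_p^{\tau,\sigma}=p^{\tau p^{\sigma}}$ for $p\ge 1$ and $M_0^{\tau,\sigma}=1$. For $h>0$ and a regular compact set $K\subset\mathbf{R}^d$, $\mathcal{E}_{\tau,\sigma,h}(K)$ is the Banach space of (complex-valued) functions $\phi\in C^\infty(K)$ with $$\|\phi\|_{\mathcal{E}_{\tau,\sigma,h}(K)}=\sup_{\alpha\in\mathbf{N}^d}\sup_{x\in K}\frac{|\partial^\alpha\phi(x)|}{h^{|\alpha|^\sigma}M_{|\alpha|}^{\tau,\sigma}}<\infty .$$ For an open set $U\subseteq\mathbf{R}^d$ (any dimension $d\ge1$): $\mathcal{E}_{\{\tau,\sigma\}}(U)=\varprojlim_{K\subset\subset U}\varinjlim_{h\to\infty}\mathcal{E}_{\tau,\sigma,h}(K)$ (Roumieu case), i.e. $\phi\in C^\infty(U)$ belongs to it iff for every compact $K\subset\subset U$ there is $h>0$ with $\|\phi\|_{\mathcal{E}_{\tau,\sigma,h}(K)}<\infty$;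 $\mathcal{E}_{(\tau,\sigma)}(U)=\varprojlim_{K\subset\subset U}\varprojlim_{h\to0}\mathcal{E}_{\tau,\sigma,h}(K)$ (Beurling case), i.e. $\phi\in C^\infty(U)$ belongs to it iff $\|\phi\|_{\mathcal{E}_{\tau,\sigma,h}(K)}<\infty$ for every compact $K\subset\subset U$ and every $h>0$. *)

theory Defs
  imports "HOL-Analysis.Analysis"
begin

text \<open>
  The definitions are stated over a class \<^class>\<open>euclidean_space\<close>, so that they apply both to
  subsets of \<^typ>\<open>real\<close> (with basis \<open>{1}\<close>) and to subsets of \<^typ>\<open>real ^ 'd\<close> (with the standard
  basis). Functions are total, but the classes of functions on an open set \<open>U\<close> only depend on the
  values taken on \<open>U\<close>.
\<close>

definition partial_deriv ::
    "'a::euclidean_space \<Rightarrow> ('a \<Rightarrow> complex) \<Rightarrow> 'a \<Rightarrow> complex" where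
  "partial_deriv b \<phi> = (\<lambda>x. frechet_derivative \<phi> (at x) b)"

text \<open>\<open>\<phi> \<in> C\<^sup>k(U)\<close>, for \<open>U\<close> open.\<close>

fun Ck_on :: "nat \<Rightarrow> 'a::euclidean_space set \<Rightarrow> ('a \<Rightarrow> complex) \<Rightarrow> bool" where
  "Ck_on 0 U \<phi> \<longleftrightarrow> continuous_on U \<phi>"
| "Ck_on (Suc k) U \<phi> \<longleftrightarrow>
     (\<forall>x\<in>U. \<phi> differentiable (at x)) \<and> (\<forall>b\<in>Basis. Ck_on k U (partial_deriv b \<phi>))"

definition smooth_on :: "'a::euclidean_space set \<Rightarrow> ('a \<Rightarrow> complex) \<Rightarrow> bool" where
  "smooth_on U \<phi> \<longleftrightarrow> (\<forall>k. Ck_on k U \<phi>)"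

text \<open>
  A multi-index is a function \<open>\<alpha>\<close> assigning a natural number to every basis vector; its values
  outside \<^const>\<open>Basis\<close> play no role. The basis of a Euclidean space carries no order, so one is fixed
  by choice in order to write down \<open>\<partial>\<^sup>\<alpha>\<close>; on smooth functions the result does not depend on it,
  since partial derivatives commute.
\<close>

definition basis_enum :: "'a::euclidean_space list" where
  "basis_enum = (SOME bs. distinct bs \<and> set bs = Basis)"

definition multi_deriv ::
    "('a::euclidean_space \<Rightarrow> nat) \<Rightarrow> ('a \<Rightarrow> complex) \<Rightarrow> 'a \<Rightarrow> complex" where
  "multi_deriv \<alpha> \<phi> = foldr (\<lambda>b. partial_deriv b ^^ \<alpha> b) basis_enum \<phi>"

definition multi_order :: "('a::euclidean_space \<Rightarrow> nat) \<Rightarrow> nat" where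
  "multi_order \<alpha> = (\<Sum>b\<in>Basis. \<alpha> b)"

text \<open>\<open>M\<^sub>p = p\<^bsup>\<tau> p\<^sup>\<sigma>\<^esup>\<close>; the case \<open>p = 0\<close> is separate because \<open>0 powr a = 0\<close> in the library.\<close>

definition weight_seq :: "real \<Rightarrow> real \<Rightarrow> nat \<Rightarrow> real" where
  "weight_seq \<tau> \<sigma> p = (if p = 0 then 1 else real p powr (\<tau> * real p powr \<sigma>))"

text \<open>The norm is extended-valued, so that its finiteness is a meaningful condition.\<close>

definition E_norm ::
    "real \<Rightarrow> real \<Rightarrow> real \<Rightarrow> 'a::euclidean_space set \<Rightarrow> ('a \<Rightarrow> complex) \<Rightarrow> ennreal" where
  "E_norm \<tau> \<sigma> h K \<phi> =
     (SUP \<alpha>. SUP x\<in>K. ennreal (norm (multi_deriv \<alpha> \<phi> x) /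
        (h powr (real (multi_order \<alpha>) powr \<sigma>) * weight_seq \<tau> \<sigma> (multi_order \<alpha>))))"

definition E_Roumieu :: "real \<Rightarrow> real \<Rightarrow> 'a::euclidean_space set \<Rightarrow> ('a \<Rightarrow> complex) set" where
  "E_Roumieu \<tau> \<sigma> U =
     {\<phi>. smooth_on U \<phi> \<and> (\<forall>K. compact K \<and> K \<subseteq> U \<longrightarrow> (\<exists>h>0. E_norm \<tau> \<sigma> h K \<phi> < \<infinity>))}"

definition E_Beurling :: "real \<Rightarrow> real \<Rightarrow> 'a::euclidean_space set \<Rightarrow> ('a \<Rightarrow> complex) set" where
  "E_Beurling \<tau> \<sigma> U =
     {\<phi>. smooth_on U \<phi> \<and> (\<forall>K. compact K \<and> K \<subseteq> U \<longrightarrow> (\<forall>h>0. E_norm \<tau> \<sigma> h K \<phi> < \<infinity>))}"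

end

theory Submission
  imports Defs "HOL-Library.Sublist" "HOL-Real_Asymp.Real_Asymp"
begin

text \<open>
  By the formula of Faa di Bruno, a derivative of \<open>f \<circ> g\<close> of order \<open>n\<close> is a sum of at most \<open>n!\<close>
  products of \<open>f\<^sup>(\<^sup>k\<^sup>) \<circ> g\<close> with derivatives of \<open>g\<close> of orders \<open>p\<^sub>1, \<dots>, p\<^sub>k \<ge> 1\<close> and
  \<open>p\<^sub>1 + \<dots> + p\<^sub>k = n\<close>. If the norms of \<open>f\<close> and \<open>g\<close> with parameter \<open>h\<close> are finite, such a product is
  at most \<open>C\<^bsup>n+1\<^esup> (h n\<^sup>\<tau>)\<^sup>S\<close> with \<open>S = k\<^sup>\<sigma> + p\<^sub>1\<^sup>\<sigma> + \<dots> + p\<^sub>k\<^sup>\<sigma>\<close>, and \<open>S \<le> n\<^sup>\<sigma> + n\<close> by convexity.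
  Except for finitely many \<open>n\<close> the base \<open>h n\<^sup>\<tau>\<close> is at least \<open>1\<close>, also when \<open>h\<close> is small, so that
  \<open>S\<close> may be replaced by \<open>n\<^sup>\<sigma> + n\<close>; the remaining factors \<open>n! C\<^bsup>n+1\<^esup> (h n\<^sup>\<tau>)\<^sup>n\<close> are
  \<open>O(exp (n\<^sup>\<sigma>))\<close>. Hence the norm of \<open>f \<circ> g\<close> with parameter \<open>e h\<close> is finite, which covers
  both cases.

  Derivatives are taken along lists of basis vectors in the fixed order of \<^const>\<open>basis_enum\<close>. The
  derivatives of \<open>g\<close> that occur are taken along sublists, which are again in this order, so the
  symmetry of higher derivatives is not needed.
\<close>

subsection \<open>Iterated partial derivatives\<close>

abbreviation iter_deriv :: "'a::euclidean_space list \<Rightarrow> ('a \<Rightarrow> complex) \<Rightarrow> 'a \<Rightarrow> complex" where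
  "iter_deriv bs \<phi> \<equiv> foldr partial_deriv bs \<phi>"

lemma partial_deriv_eqI:
  assumes "(\<phi> has_derivative \<phi>') (at x)"
  shows "partial_deriv b \<phi> x = \<phi>' b"
  using frechet_derivative_at[OF assms] by (simp add: partial_deriv_def)

lemma differentiable_transform_open:
  assumes "\<phi> differentiable (at x)" "open S" "x \<in> S" "\<And>y. y \<in> S \<Longrightarrow> \<psi> y = \<phi> y"
  shows "\<psi> differentiable (at x)"
  using assms unfolding differentiable_def
  by (metis has_derivative_transform_within_open)

lemma partial_deriv_transform_open:
  assumes "\<phi> differentiable (at x)" "open S" "x \<in> S" "\<And>y. y \<in> S \<Longrightarrow> \<psi> y = \<phi> y"
  shows "partial_deriv b \<psi> x = partial_deriv b \<phi> x"
proof -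
  obtain \<phi>' where d: "(\<phi> has_derivative \<phi>') (at x)"
    using assms(1) unfolding differentiable_def by blast
  have "(\<psi> has_derivative \<phi>') (at x)"
    by (rule has_derivative_transform_within_open[OF d assms(2,3)]) (simp add: assms(4))
  with d show ?thesis
    by (simp add: partial_deriv_eqI)
qed

lemma partial_deriv_mult:
  assumes "\<phi> differentiable (at x)" "\<psi> differentiable (at x)"
  shows "partial_deriv b (\<lambda>x. \<phi> x * \<psi> x) x =
    \<phi> x * partial_deriv b \<psi> x + partial_deriv b \<phi> x * \<psi> x"
proof -
  obtain \<phi>' \<psi>' where d: "(\<phi> has_derivative \<phi>') (at x)" "(\<psi> has_derivative \<psi>') (at x)"
    using assms unfolding differentiable_def by blast
  show ?thesis
    using partial_deriv_eqI[OF has_derivative_mult[OF d]] d by (simp add: partial_deriv_eqI)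
qed

lemma partial_deriv_sum_list:
  assumes "\<And>t. t \<in> set ts \<Longrightarrow> F t differentiable (at x)"
  shows "(\<lambda>x. \<Sum>t\<leftarrow>ts. F t x) differentiable (at x) \<and>
    partial_deriv b (\<lambda>x. \<Sum>t\<leftarrow>ts. F t x) x = (\<Sum>t\<leftarrow>ts. partial_deriv b (F t) x)"
  using assms
proof (induction ts)
  case Nil
  show ?case
    using partial_deriv_eqI[OF has_derivative_const, of b 0 x] by simp
next
  case (Cons t ts)
  then obtain F' S' where d: "(F t has_derivative F') (at x)"
      "((\<lambda>x. \<Sum>t\<leftarrow>ts. F t x) has_derivative S') (at x)"
    unfolding differentiable_def by (metis list.set_intros(1,2))
  show ?case
    using Cons partial_deriv_eqI[OF has_derivative_add[OF d]] d
    by (simp add: partial_deriv_eqI)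
qed

text \<open>\<open>partial_deriv\<close> acts on complex-valued functions only, so the real function
  \<open>g\<close> enters through its complexification, whose real part is then used to recover its
  derivative.\<close>

lemma partial_deriv_compose:
  fixes F :: "real \<Rightarrow> complex" and g :: "'a::euclidean_space \<Rightarrow> real"
  assumes F: "F differentiable (at (g x))" and g: "(\<lambda>x. complex_of_real (g x)) differentiable (at x)"
  shows "(\<lambda>x. F (g x)) differentiable (at x)"
    and "partial_deriv b (\<lambda>x. F (g x)) x =
      partial_deriv 1 F (g x) * partial_deriv b (\<lambda>x. complex_of_real (g x)) x"
proof -
  obtain G' where G': "((\<lambda>x. complex_of_real (g x)) has_derivative G') (at x)"
    using g unfolding differentiable_def by blast
  obtain F' where F': "(F has_derivative F') (at (g x))"
    using F unfolding differentiable_def by blast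
  define g' where "g' = (\<lambda>v. Re (G' v))"
  have g': "(g has_derivative g') (at x)"
    using has_derivative_Re[OF G'] by (simp add: g'_def)
  have comp: "((\<lambda>x. F (g x)) has_derivative (\<lambda>v. F' (g' v))) (at x)"
    using has_derivative_compose[OF g' F'] .
  then show "(\<lambda>x. F (g x)) differentiable (at x)"
    unfolding differentiable_def by blast
  interpret F': bounded_linear F'
    using F' by (rule has_derivative_bounded_linear)
  \<comment> \<open>\<open>F'\<close> is real linear on the line, hence determined by its value at
    1, the only basis vector there.\<close>
  have "F' (g' b) = F' (g' b *\<^sub>R 1)"
    by simp
  also have "\<dots> = of_real (g' b) * F' 1"
    by (simp only: F'.scaleR) (simp add: scaleR_conv_of_real)
  finally have "F' (g' b) = F' 1 * of_real (g' b)"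
    by simp
  moreover have "partial_deriv b (\<lambda>x. complex_of_real (g x)) x = of_real (g' b)"
    using partial_deriv_eqI[OF has_derivative_of_real[OF g']] .
  ultimately show "partial_deriv b (\<lambda>x. F (g x)) x =
      partial_deriv 1 F (g x) * partial_deriv b (\<lambda>x. complex_of_real (g x)) x"
    by (simp add: partial_deriv_eqI[OF comp] partial_deriv_eqI[OF F'])
qed

lemma smooth_on_imp_iter_deriv_differentiable:
  assumes "smooth_on U \<phi>" "set bs \<subseteq> Basis" "x \<in> U"
  shows "iter_deriv bs \<phi> differentiable (at x)"
proof -
  \<comment> \<open>\<open>foldr\<close> applies the last direction first, and \<open>Ck_on\<close>
    also peels off the innermost derivative; hence the induction from the right end of the
    list.\<close>
  have "Ck_on (Suc (length bs)) U \<phi> \<Longrightarrow> set bs \<subseteq> Basis \<Longrightarrow> iter_deriv bs \<phi> differentiable (at x)"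
  proof (induction bs arbitrary: \<phi> rule: rev_induct)
    case Nil
    then show ?case using assms(3) by simp
  next
    case (snoc b bs)
    then show ?case by simp
  qed
  then show ?thesis
    using assms unfolding smooth_on_def by blast
qed

text \<open>The continuity at the bottom of the recursion for \<open>Ck_on\<close> comes from
  differentiability there.\<close>

lemma smooth_onI:
  assumes "\<And>bs x. set bs \<subseteq> Basis \<Longrightarrow> x \<in> U \<Longrightarrow> iter_deriv bs \<phi> differentiable (at x)"
  shows "smooth_on U \<phi>"
proof -
  have "Ck_on k U \<phi>" for k
    using assms
  proof (induction k arbitrary: \<phi>)
    case 0
    have "\<phi> differentiable (at x)" if "x \<in> U" for x
      using 0[of "[]" x] that by simp
    then show ?case
      by (auto intro!: continuous_at_imp_continuous_on differentiable_imp_continuous_within)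
  next
    case (Suc k)
    have "\<phi> differentiable (at x)" if "x \<in> U" for x
      using Suc.prems[of "[]" x] that by simp
    moreover have "Ck_on k U (partial_deriv b \<phi>)" if "b \<in> Basis" for b
    proof (rule Suc.IH)
      fix bs x assume "set bs \<subseteq> (Basis :: 'a set)" "x \<in> U"
      then show "iter_deriv bs (partial_deriv b \<phi>) differentiable (at x)"
        using Suc.prems[of "bs @ [b]" x] that by simp
    qed
    ultimately show ?case by simp
  qed
  then show ?thesis by (simp add: smooth_on_def)
qed

subsection \<open>The formula of Faa di Bruno\<close>

text \<open>Encodes the product rule: a block stands for a derivative of \<open>g\<close>, a list of
  blocks for the product of these, and each entry of the result differentiates exactly one factor in
  direction \<open>b\<close>.\<close>

primrec insert_block :: "'b \<Rightarrow> 'b list list \<Rightarrow> 'b list list list" where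
  "insert_block b [] = []"
| "insert_block b (l # ls) = ((b # l) # ls) # map ((#) l) (insert_block b ls)"

text \<open>All partitions of a list into nonempty subsequences, one for each set partition of the positions.\<close>

primrec list_partitions :: "'b list \<Rightarrow> 'b list list list" where
  "list_partitions [] = [[]]"
| "list_partitions (b # bs) =
     concat (map (\<lambda>ls. ([b] # ls) # insert_block b ls) (list_partitions bs))"

lemma set_subseq: "subseq xs ys \<Longrightarrow> set xs \<subseteq> set ys"
  by (induction rule: list_emb.induct) auto

lemma length_insert_block [simp]: "length (insert_block b ls) = length ls"
  by (induction ls) auto

lemma insert_block_length:
  "ls' \<in> set (insert_block b ls) \<Longrightarrow>
    length ls' = length ls \<and> sum_list (map length ls') = Suc (sum_list (map length ls))"
  by (induction ls arbitrary: ls') auto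

lemma insert_block_elem:
  "ls' \<in> set (insert_block b ls) \<Longrightarrow> l \<in> set ls' \<Longrightarrow> l \<in> set ls \<or> (\<exists>l0\<in>set ls. l = b # l0)"
  by (induction ls arbitrary: ls') fastforce+

text \<open>New directions are only ever put in front of a block or form a block of their own, so
  each block inherits the order of \<open>bs\<close>.\<close>

lemma list_partitions_blocks:
  "ls \<in> set (list_partitions bs) \<Longrightarrow> l \<in> set ls \<Longrightarrow> l \<noteq> [] \<and> subseq l bs"
proof (induction bs arbitrary: ls l)
  case (Cons b bs)
  then obtain ls0 where ls0: "ls0 \<in> set (list_partitions bs)" "ls = [b] # ls0 \<or> ls \<in> set (insert_block b ls0)"
    by auto
  then have "l = [b] \<or> l \<in> set ls0 \<or> (\<exists>l0\<in>set ls0. l = b # l0)"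
    using Cons.prems(2) insert_block_elem by fastforce
  then show ?case
    using Cons.IH[OF ls0(1)] by (auto intro: list_emb_Cons)
qed auto

lemma list_partitions_sum_length:
  "ls \<in> set (list_partitions bs) \<Longrightarrow> sum_list (map length ls) = length bs"
  by (induction bs arbitrary: ls) (auto dest: insert_block_length)

lemma list_partitions_length:
  assumes "ls \<in> set (list_partitions bs)"
  shows "length ls \<le> length bs"
proof -
  have "(\<Sum>l\<leftarrow>ls. 1) \<le> (\<Sum>l\<leftarrow>ls. length l)"
    using list_partitions_blocks[OF assms] by (intro sum_list_mono) (auto simp: Suc_le_eq)
  then show ?thesis
    using list_partitions_sum_length[OF assms] by (simp add: sum_list_triv)
qed

text \<open>A partition of \<open>bs\<close> with k blocks extends in k + 1 ways, since the new
  element forms its own block or joins one of the k, and k is at most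
  \<open>length bs\<close>.\<close>

lemma length_list_partitions: "length (list_partitions bs) \<le> fact (length bs)"
proof (induction bs)
  case (Cons b bs)
  have "length (list_partitions (b # bs)) = (\<Sum>ls\<leftarrow>list_partitions bs. Suc (length ls))"
    by (simp add: length_concat o_def)
  also have "\<dots> \<le> (\<Sum>ls\<leftarrow>list_partitions bs. Suc (length bs))"
    by (intro sum_list_mono) (auto dest: list_partitions_length)
  also have "\<dots> = length (list_partitions bs) * Suc (length bs)"
    by (simp add: sum_list_triv)
  also have "\<dots> \<le> fact (length bs) * Suc (length bs)"
    using Cons by (rule mult_right_mono) simp
  finally show ?case by (simp add: algebra_simps)
qed simp

lemma sum_list_map_concat:
  fixes F :: "'b \<Rightarrow> complex"
  shows "(\<Sum>t\<leftarrow>concat tss. F t) = (\<Sum>ts\<leftarrow>tss. \<Sum>t\<leftarrow>ts. F t)"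
  by (induction tss) auto

lemma partial_deriv_prod_list:
  assumes "\<And>l. l \<in> set ls \<Longrightarrow> iter_deriv l G differentiable (at x)"
  shows "(\<lambda>x. \<Prod>l\<leftarrow>ls. iter_deriv l G x) differentiable (at x) \<and>
    partial_deriv b (\<lambda>x. \<Prod>l\<leftarrow>ls. iter_deriv l G x) x =
      (\<Sum>ls'\<leftarrow>insert_block b ls. \<Prod>l\<leftarrow>ls'. iter_deriv l G x)"
  using assms
proof (induction ls)
  case Nil
  show ?case
    using partial_deriv_eqI[OF has_derivative_const, of b 1 x] by simp
next
  case (Cons l ls)
  then show ?case
    by (simp add: partial_deriv_mult o_def sum_list_const_mult)
qed

text \<open>Induction on \<open>bs\<close>, differentiating the sum term by term; the extensions of
  a partition by a new element match the summands that the chain and product rules produce.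
  Differentiability then follows from that of the terms.\<close>

lemma iter_deriv_compose:
  fixes f :: "real \<Rightarrow> complex" and g :: "'a::euclidean_space \<Rightarrow> real"
  assumes "smooth_on U f" "smooth_on V (\<lambda>x. complex_of_real (g x))" "open V" "g ` V \<subseteq> U"
    and "set bs \<subseteq> Basis" "x \<in> V"
  shows "iter_deriv bs (f \<circ> g) x = (\<Sum>ls\<leftarrow>list_partitions bs.
      iter_deriv (replicate (length ls) 1) f (g x) *
      (\<Prod>l\<leftarrow>ls. iter_deriv l (\<lambda>x. complex_of_real (g x)) x))" (is "_ = (\<Sum>ls\<leftarrow>_. ?T ls x)")
    and "iter_deriv bs (f \<circ> g) differentiable (at x)"
proof -
  \<comment> \<open>Differentiating the outer factor raises the order of the derivative of
    \<open>f\<close> by one and creates the singleton block \<open>[b]\<close>; differentiating the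
    product inserts \<open>b\<close> into an existing block.\<close>
  have term_deriv: "?T ls differentiable (at x) \<and>
      partial_deriv b (?T ls) x = (\<Sum>ls'\<leftarrow>([b] # ls) # insert_block b ls. ?T ls' x)"
    if "\<And>l. l \<in> set ls \<Longrightarrow> set l \<subseteq> Basis" "x \<in> V" for ls b x
  proof -
    let ?G = "\<lambda>x. complex_of_real (g x)"
    let ?F = "iter_deriv (replicate (length ls) 1) f"
    have F: "?F differentiable (at (g x))"
      using assms(4) that(2)
      by (intro smooth_on_imp_iter_deriv_differentiable[OF assms(1)]) auto
    have G: "iter_deriv l ?G differentiable (at x)" if "set l \<subseteq> Basis" for l
      using smooth_on_imp_iter_deriv_differentiable[OF assms(2) that \<open>x \<in> V\<close>] .
    note C = partial_deriv_compose[where g = g, OF F G[of "[]", simplified]]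
    have P: "(\<lambda>x. \<Prod>l\<leftarrow>ls. iter_deriv l ?G x) differentiable (at x)"
      "partial_deriv b (\<lambda>x. \<Prod>l\<leftarrow>ls. iter_deriv l ?G x) x =
        (\<Sum>ls'\<leftarrow>insert_block b ls. \<Prod>l\<leftarrow>ls'. iter_deriv l ?G x)"
      using partial_deriv_prod_list[of ls ?G x b] G that(1) by blast+
    \<comment> \<open>Insertion keeps the number of blocks, so the order of the derivative of
      \<open>f\<close> is unchanged.\<close>
    have "(\<Sum>ls'\<leftarrow>insert_block b ls. ?T ls' x) =
        (\<Sum>ls'\<leftarrow>insert_block b ls. ?F (g x) * (\<Prod>l\<leftarrow>ls'. iter_deriv l ?G x))"
      by (intro arg_cong[of _ _ sum_list] map_cong refl) (auto dest: insert_block_length)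
    then show ?thesis
      using C(1) P(1) by (simp add: partial_deriv_mult C(2) P(2) sum_list_const_mult del: foldr_replicate)
  qed
  \<comment> \<open>The formula is proved on all of the open set \<open>V\<close> at once, because
    differentiating it at a point requires it in a neighbourhood.\<close>
  have "\<forall>x\<in>V. iter_deriv bs (f \<circ> g) x = (\<Sum>ls\<leftarrow>list_partitions bs. ?T ls x)"
    using assms(5)
  proof (induction bs)
    case Nil
    then show ?case by simp
  next
    case (Cons b bs)
    show ?case
    proof
      fix x assume x: "x \<in> V"
      have bl: "set l \<subseteq> Basis" if "ls \<in> set (list_partitions bs)" "l \<in> set ls" for ls l
        using list_partitions_blocks[OF that] Cons.prems by (auto dest: set_subseq)
      have T: "?T ls differentiable (at x)"
        "partial_deriv b (?T ls) x = (\<Sum>ls'\<leftarrow>([b] # ls) # insert_block b ls. ?T ls' x)"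
        if "ls \<in> set (list_partitions bs)" for ls
        using term_deriv[of ls x b, OF bl[OF that] x] by blast+
      note S = partial_deriv_sum_list[of "list_partitions bs" ?T x b, OF T(1)]
      have "partial_deriv b (iter_deriv bs (f \<circ> g)) x =
          partial_deriv b (\<lambda>x. \<Sum>ls\<leftarrow>list_partitions bs. ?T ls x) x"
      proof (rule partial_deriv_transform_open[OF _ assms(3) x])
        show "(\<lambda>x. \<Sum>ls\<leftarrow>list_partitions bs. ?T ls x) differentiable (at x)"
          using S by blast
        fix y assume "y \<in> V"
        moreover have "set bs \<subseteq> Basis"
          using Cons.prems by simp
        ultimately show "iter_deriv bs (f \<circ> g) y = (\<Sum>ls\<leftarrow>list_partitions bs. ?T ls y)"
          using Cons.IH by blast
      qed
      then have "iter_deriv (b # bs) (f \<circ> g) x = partial_deriv b (\<lambda>x. \<Sum>ls\<leftarrow>list_partitions bs. ?T ls x) x"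
        by simp
      also have "\<dots> = (\<Sum>ls\<leftarrow>list_partitions bs. partial_deriv b (?T ls) x)"
        using S by blast
      also have "\<dots> = (\<Sum>ls\<leftarrow>list_partitions bs. \<Sum>ls'\<leftarrow>([b] # ls) # insert_block b ls. ?T ls' x)"
        using T(2) by (intro arg_cong[of _ _ sum_list] map_cong refl) blast
      also have "\<dots> = (\<Sum>ls\<leftarrow>list_partitions (b # bs). ?T ls x)"
        by (simp add: sum_list_map_concat o_def)
      finally show "iter_deriv (b # bs) (f \<circ> g) x = (\<Sum>ls\<leftarrow>list_partitions (b # bs). ?T ls x)" .
    qed
  qed
  note eq = this
  then show "iter_deriv bs (f \<circ> g) x = (\<Sum>ls\<leftarrow>list_partitions bs. ?T ls x)"
    using assms(6) by blast
  have bl: "set l \<subseteq> Basis" if "ls \<in> set (list_partitions bs)" "l \<in> set ls" for ls l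
    using list_partitions_blocks[OF that] assms(5) by (auto dest: set_subseq)
  have "?T ls differentiable (at x)" if "ls \<in> set (list_partitions bs)" for ls
    using term_deriv[OF bl[OF that] assms(6)] by blast
  note S = partial_deriv_sum_list[of "list_partitions bs" ?T x, OF this]
  show "iter_deriv bs (f \<circ> g) differentiable (at x)"
  proof (rule differentiable_transform_open[OF _ assms(3,6)])
    show "(\<lambda>x. \<Sum>ls\<leftarrow>list_partitions bs. ?T ls x) differentiable (at x)"
      using S by blast
  qed (use eq in blast)
qed

lemma smooth_on_compose:
  fixes f :: "real \<Rightarrow> complex" and g :: "'a::euclidean_space \<Rightarrow> real"
  assumes "smooth_on U f" "smooth_on V (\<lambda>x. complex_of_real (g x))" "open V" "g ` V \<subseteq> U"
  shows "smooth_on V (f \<circ> g)"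
  using iter_deriv_compose(2)[OF assms] by (rule smooth_onI)

subsection \<open>Multi-indices as lists of directions\<close>

definition multi_list :: "'b list \<Rightarrow> ('b \<Rightarrow> nat) \<Rightarrow> 'b list" where
  "multi_list es \<alpha> = concat (map (\<lambda>b. replicate (\<alpha> b) b) es)"

lemma basis_enum: "distinct (basis_enum :: 'a::euclidean_space list)"
    "set (basis_enum :: 'a list) = Basis"
proof -
  have "\<exists>bs. distinct bs \<and> set bs = (Basis :: 'a set)"
    using finite_distinct_list[OF finite_Basis] by blast
  then have "distinct (basis_enum :: 'a list) \<and> set (basis_enum :: 'a list) = Basis"
    unfolding basis_enum_def by (rule someI_ex)
  then show "distinct (basis_enum :: 'a list)" "set (basis_enum :: 'a list) = Basis"
    by auto
qed

lemma multi_deriv_eq: "multi_deriv \<alpha> \<phi> = iter_deriv (multi_list basis_enum \<alpha>) \<phi>"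
proof -
  have "foldr (\<lambda>b. partial_deriv b ^^ \<alpha> b) es \<phi> = iter_deriv (multi_list es \<alpha>) \<phi>" for es
    by (induction es) (auto simp: multi_list_def foldr_replicate)
  then show ?thesis by (simp add: multi_deriv_def)
qed

lemma length_multi_list: "length (multi_list basis_enum \<alpha>) = multi_order \<alpha>"
  using sum_list_distinct_conv_sum_set[OF basis_enum(1), of \<alpha>]
  by (simp add: basis_enum(2) multi_list_def length_concat o_def multi_order_def)

lemma set_multi_list: "set (multi_list basis_enum \<alpha>) \<subseteq> Basis"
  using basis_enum(2) by (auto simp: multi_list_def)

text \<open>A list that runs through \<open>es\<close> with multiplicities keeps this shape when
  entries are dropped. Derivatives along such sublists are therefore of the form
  \<open>multi_deriv\<close> and are controlled by the norm.\<close>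

lemma subseq_multi_list:
  assumes "subseq l (multi_list es \<alpha>)" "distinct es"
  shows "\<exists>\<beta>. l = multi_list es \<beta>"
  using assms
proof (induction es arbitrary: l)
  case Nil
  then show ?case by (simp add: multi_list_def)
next
  case (Cons e es)
  then obtain us vs where l: "l = us @ vs" "subseq us (replicate (\<alpha> e) e)" "subseq vs (multi_list es \<alpha>)"
    by (auto simp: multi_list_def elim: subseq_appendE)
  obtain \<beta> where \<beta>: "vs = multi_list es \<beta>"
    using Cons l(3) by auto
  have us: "us = replicate (length us) e"
    using set_subseq[OF l(2)]
    by (intro replicate_eqI) auto
  \<comment> \<open>By distinctness \<open>e\<close> does not occur in \<open>es\<close>, so
    resetting its multiplicity leaves the tail alone.\<close>
  have "map (\<lambda>b. replicate ((\<beta>(e := length us)) b) b) es = map (\<lambda>b. replicate (\<beta> b) b) es"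
    using Cons.prems(2) by (intro map_cong) auto
  then have "l = multi_list (e # es) (\<beta>(e := length us))"
    using l(1) \<beta> us[symmetric] by (simp only: multi_list_def list.map concat.simps fun_upd_same)
  then show ?case by blast
qed

lemma basis_enum_real: "(basis_enum :: real list) = [1]"
proof -
  have set: "set (basis_enum :: real list) = {1}"
    by (simp add: basis_enum)
  then have "length (basis_enum :: real list) = Suc 0"
    using distinct_card[OF basis_enum(1)[where 'a = real]] by simp
  then obtain y where y: "(basis_enum :: real list) = [y]"
    by (auto simp: length_Suc_conv)
  then show ?thesis
    using set unfolding y by simp
qed

subsection \<open>The estimate\<close>

text \<open>By convexity the increment of the power over a step of length \<open>q - 1\<close> grows
  with the starting point; compare the starting points 1 and \<open>p\<close>.\<close>

lemma powr_add_powr_le: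
  fixes p q s :: real
  assumes "p \<ge> 1" "q \<ge> 1" "s \<ge> 1"
  shows "p powr s + q powr s \<le> (p + q - 1) powr s + 1"
proof -
  let ?u = "\<lambda>t. (t + (q - 1)) powr s - t powr s"
  have "?u 1 \<le> ?u p"
  proof (rule DERIV_nonneg_imp_nondecreasing[OF assms(1)])
    fix t assume t: "1 \<le> t" "t \<le> p"
    have "(?u has_real_derivative (s * (t + (q - 1)) powr (s - 1) - s * t powr (s - 1))) (at t)"
      using t assms by (auto intro!: derivative_eq_intros)
    moreover have "t powr (s - 1) \<le> (t + (q - 1)) powr (s - 1)"
      using t assms by (intro powr_mono2) auto
    then have "0 \<le> s * (t + (q - 1)) powr (s - 1) - s * t powr (s - 1)"
      using assms by (simp add: mult_left_mono)
    ultimately show "\<exists>y. (?u has_real_derivative y) (at t) \<and> 0 \<le> y" by blast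
  qed
  then show ?thesis by (simp add: algebra_simps)
qed

text \<open>\<open>p\<close> is an accumulator: each \<open>q\<close> is merged into it as
  \<open>p + q - 1\<close> at the cost of an additive 1.\<close>

lemma sum_list_powr_le:
  fixes s p :: real
  assumes "s \<ge> 1" "p \<ge> 1" "\<And>q. q \<in> set ps \<Longrightarrow> q \<ge> 1"
  shows "p powr s + (\<Sum>q\<leftarrow>ps. q powr s) \<le> (p + sum_list ps - length ps) powr s + length ps"
  using assms(2,3)
proof (induction ps arbitrary: p)
  case (Cons q ps)
  have q: "q \<ge> 1"
    by (rule Cons.prems(2)) simp
  have "p powr s + q powr s \<le> (p + q - 1) powr s + 1"
    using Cons.prems assms(1) by (intro powr_add_powr_le) auto
  moreover have "(p + q - 1) powr s + (\<Sum>q\<leftarrow>ps. q powr s)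
      \<le> (p + q - 1 + sum_list ps - length ps) powr s + length ps"
    
  proof (rule Cons.IH)
    show "1 \<le> p + q - 1"
      using Cons.prems(1) q by simp
  qed (use Cons.prems(2) in simp)
  ultimately show ?case by (simp add: algebra_simps)
qed auto

lemma eventually_le_imp_le_mult:
  fixes a b :: "nat \<Rightarrow> real"
  assumes "eventually (\<lambda>n. a n \<le> b n) sequentially" "\<And>n. b n > 0"
  obtains C where "C \<ge> 1" "\<And>n. a n \<le> C * b n"
proof -
  obtain N where N: "\<And>n. n \<ge> N \<Longrightarrow> a n \<le> b n"
    using assms(1) by (auto simp: eventually_sequentially)
  \<comment> \<open>The finitely many exceptional indices are absorbed by their largest ratio; the
    inserted 1 handles all other indices.\<close>
  define C where "C = Max (insert 1 ((\<lambda>n. a n / b n) ` {..<N}))"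
  have C: "C \<ge> 1"
    by (simp add: C_def)
  have "a n \<le> C * b n" for n
  proof (cases "n < N")
    case True
    then have "a n / b n \<le> C"
      unfolding C_def by (intro Max_ge) auto
    then show ?thesis
      using assms(2)[of n] by (simp add: field_simps)
  next
    case False
    then have "a n \<le> 1 * b n"
      using N by simp
    also have "\<dots> \<le> C * b n"
      using C assms(2)[of n] by (intro mult_right_mono) auto
    finally show ?thesis .
  qed
  with C show thesis by (rule that)
qed

text \<open>Enlarging \<open>h\<close> by the factor \<open>exp 1\<close> gains
  \<open>exp (n powr \<sigma>)\<close>, which for \<open>\<sigma> > 1\<close> dominates every factor
  of size \<open>exp (O(n ln n))\<close>.\<close>

lemma weight_estimate:
  fixes \<tau> \<sigma> h C :: real
  assumes "\<tau> > 0" "\<sigma> > 1" "h > 0" "C \<ge> 1"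
  obtains C' where "C' \<ge> 1" "\<And>n. n \<ge> 1 \<Longrightarrow>
    fact n * C ^ (n + 1) * max 1 ((h * real n powr \<tau>) powr (real n powr \<sigma> + n))
      \<le> C' * ((exp 1 * h) powr (real n powr \<sigma>) * weight_seq \<tau> \<sigma> n)"
proof -
  have ev1: "eventually (\<lambda>n::nat. h * real n powr \<tau> \<ge> 1) sequentially"
    using assms by real_asymp
  \<comment> \<open>The left side adds up the logarithms of \<open>n ^ n\<close>, which bounds the
    factorial, of \<open>C ^ (n + 1)\<close>, and of the surplus power
    \<open>(h * real n powr \<tau>) ^ n\<close>.\<close>
  have ev2: "eventually (\<lambda>n::nat. real n * ln n + (real n + 1) * ln C + n * (ln h + \<tau> * ln n) \<le> real n powr \<sigma>) sequentially"
    using assms by real_asymp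
  have ev: "eventually (\<lambda>n. fact n * C ^ (n + 1) * max 1 ((h * real n powr \<tau>) powr (real n powr \<sigma> + n))
      \<le> (exp 1 * h) powr (real n powr \<sigma>) * weight_seq \<tau> \<sigma> n) sequentially"
    using ev1 ev2 eventually_ge_at_top[of 1]
  proof eventually_elim
    case (elim n)
    have n: "real n > 0" using elim by simp
    have hn: "h * real n powr \<tau> = exp (ln h + \<tau> * ln n)"
      using assms n by (simp add: exp_add powr_def)
    have "fact n \<le> real n ^ n"
      using fact_le_power[of n] by (metis of_nat_power)
    also have "\<dots> = exp (real n * ln n)"
      using n by (simp add: exp_of_nat_mult)
    finally have 1: "fact n \<le> exp (real n * ln n)" .
    have 2: "C ^ (n + 1) = exp ((real n + 1) * ln C)"
      using assms exp_of_nat_mult[of "n + 1" "ln C"] by (simp add: add.commute)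
    have 3: "max 1 ((h * real n powr \<tau>) powr (real n powr \<sigma> + n))
        = exp ((real n powr \<sigma> + n) * (ln h + \<tau> * ln n))"
      using elim(1) ge_one_powr_ge_zero[OF elim(1), of "real n powr \<sigma> + n"]
      by (simp add: max_def hn exp_powr_real algebra_simps)
    have 4: "(exp 1 * h) powr (real n powr \<sigma>) * weight_seq \<tau> \<sigma> n
        = exp (real n powr \<sigma> * (1 + ln h) + \<tau> * real n powr \<sigma> * ln n)"
      using assms n by (simp add: weight_seq_def powr_def exp_add ln_mult algebra_simps)
    have "fact n * C ^ (n + 1) * max 1 ((h * real n powr \<tau>) powr (real n powr \<sigma> + n))
        \<le> exp (real n * ln n) * exp ((real n + 1) * ln C) * exp ((real n powr \<sigma> + n) * (ln h + \<tau> * ln n))"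
      unfolding 2 3 using 1 by (intro mult_right_mono) auto
    \<comment> \<open>The last summand is the logarithm of
      \<open>h powr (real n powr \<sigma>) * weight_seq \<tau> \<sigma> n\<close>; the rest is
      bounded by \<open>ev2\<close>.\<close>
    also have "\<dots> = exp ((real n * ln n + (real n + 1) * ln C + n * (ln h + \<tau> * ln n))
        + real n powr \<sigma> * (ln h + \<tau> * ln n))"
      by (simp add: exp_add[symmetric] algebra_simps)
    also have "\<dots> \<le> exp (real n powr \<sigma> + real n powr \<sigma> * (ln h + \<tau> * ln n))"
      using elim(2) by simp
    also have "\<dots> = (exp 1 * h) powr (real n powr \<sigma>) * weight_seq \<tau> \<sigma> n"
      unfolding 4 by (simp add: algebra_simps)
    finally show ?case .
  qed
  have pos: "(exp 1 * h) powr (real n powr \<sigma>) * weight_seq \<tau> \<sigma> n > 0" for n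
    using assms by (simp add: weight_seq_def)
  show thesis
    by (rule eventually_le_imp_le_mult[OF ev pos], rule that)
qed

section \<open>Bounds for single terms of the Faa di Bruno sum\<close>

lemma weight_seq_pos: "weight_seq \<tau> \<sigma> n > 0"
  by (simp add: weight_seq_def)

text \<open>Only the base is enlarged from \<open>p\<close> to \<open>n\<close>. All factors of a
  term then share the base \<open>h * real n powr \<tau>\<close>, and their exponents can be
  added.\<close>

lemma weight_seq_le:
  assumes "\<tau> > 0" "h > 0" "1 \<le> p" "p \<le> n"
  shows "h powr (real p powr \<sigma>) * weight_seq \<tau> \<sigma> p \<le> (h * real n powr \<tau>) powr (real p powr \<sigma>)"
proof -
  have "real p powr (\<tau> * real p powr \<sigma>) \<le> real n powr (\<tau> * real p powr \<sigma>)"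
    using assms by (intro powr_mono2) auto
  then show ?thesis
    using assms by (simp add: weight_seq_def powr_mult powr_powr mult_left_mono)
qed

lemma norm_prod_list_le:
  fixes F :: "'b \<Rightarrow> complex" and A C :: real
  assumes "C \<ge> 0" "\<And>l. l \<in> set ls \<Longrightarrow> norm (F l) \<le> C * A powr w l" "A > 0"
  shows "norm (\<Prod>l\<leftarrow>ls. F l) \<le> C ^ length ls * A powr (\<Sum>l\<leftarrow>ls. w l)"
  using assms(2)
proof (induction ls)
  case (Cons l ls)
  have "norm (F l * (\<Prod>l\<leftarrow>ls. F l)) \<le> (C * A powr w l) * (C ^ length ls * A powr (\<Sum>l\<leftarrow>ls. w l))"
    unfolding norm_mult using Cons assms(1) by (intro mult_mono) auto
  then show ?case by (simp add: powr_add mult_ac)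
qed (use assms in simp)

lemma norm_sum_list_le:
  fixes F :: "'b \<Rightarrow> complex" and B :: real
  assumes "\<And>t. t \<in> set ts \<Longrightarrow> norm (F t) \<le> B"
  shows "norm (\<Sum>t\<leftarrow>ts. F t) \<le> length ts * B"
  using assms
proof (induction ts)
  case (Cons t ts)
  have "norm (F t + (\<Sum>t\<leftarrow>ts. F t)) \<le> norm (F t) + norm (\<Sum>t\<leftarrow>ts. F t)"
    by (rule norm_triangle_ineq)
  also have "\<dots> \<le> B + length ts * B"
    using Cons by (intro add_mono) auto
  finally show ?case by (simp add: algebra_simps)
qed simp

text \<open>Take the number k of blocks as accumulator in \<open>sum_list_powr_le\<close>: the block
  sizes add up to n, so the final base is k + n - k = n, and the additive cost k is at most
  n.\<close>

lemma list_partitions_powr_le: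
  fixes \<sigma> :: real
  assumes "ls \<in> set (list_partitions bs)" "bs \<noteq> []" "\<sigma> \<ge> 1"
  shows "real (length ls) powr \<sigma> + (\<Sum>l\<leftarrow>ls. real (length l) powr \<sigma>)
    \<le> real (length bs) powr \<sigma> + length bs"
proof -
  have *: "(\<Sum>l\<leftarrow>ls. real (length l)) = real (sum_list (map length ls))"
    by (induction ls) auto
  have sum: "(\<Sum>l\<leftarrow>ls. real (length l)) = length bs"
    using list_partitions_sum_length[OF assms(1)]
    by (metis *)
  have "ls \<noteq> []"
    using list_partitions_sum_length[OF assms(1)] assms(2) by auto
  then have "real (length ls) \<ge> 1"
    by (simp add: Suc_le_eq)
  then have "real (length ls) powr \<sigma> + (\<Sum>q\<leftarrow>map (\<lambda>l. real (length l)) ls. q powr \<sigma>)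
      \<le> (length ls + sum_list (map (\<lambda>l. real (length l)) ls) - length (map (\<lambda>l. real (length l)) ls)) powr \<sigma>
        + length (map (\<lambda>l. real (length l)) ls)"
    using list_partitions_blocks[OF assms(1)] assms(3)
    by (intro sum_list_powr_le) (auto simp: Suc_le_eq)
  then show ?thesis
    using list_partitions_length[OF assms(1)] by (simp add: sum o_def)
qed

section \<open>Finiteness of the norm as a family of pointwise bounds\<close>

lemma E_norm_finiteD:
  assumes "E_norm \<tau> \<sigma> h K \<phi> < \<infinity>" "h > 0"
  obtains C where "C \<ge> 1" "\<And>\<alpha> x. x \<in> K \<Longrightarrow> norm (multi_deriv \<alpha> \<phi> x) \<le>
    C * (h powr (real (multi_order \<alpha>) powr \<sigma>) * weight_seq \<tau> \<sigma> (multi_order \<alpha>))"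
proof -
  \<comment> \<open>Finiteness makes \<open>enn2real\<close> return the true value of the norm; the
    maximum provides \<open>C \<ge> 1\<close>.\<close>
  define C where "C = max 1 (enn2real (E_norm \<tau> \<sigma> h K \<phi>))"
  have E: "E_norm \<tau> \<sigma> h K \<phi> \<le> ennreal C"
    using assms(1) ennreal_leI[of "enn2real (E_norm \<tau> \<sigma> h K \<phi>)" C] by (simp add: C_def)
  have "norm (multi_deriv \<alpha> \<phi> x) \<le>
      C * (h powr (real (multi_order \<alpha>) powr \<sigma>) * weight_seq \<tau> \<sigma> (multi_order \<alpha>))"
    (is "_ \<le> C * ?w") if "x \<in> K" for \<alpha> x
  proof -
    have w: "?w > 0"
      using assms(2) by (simp add: weight_seq_pos)
    have "ennreal (norm (multi_deriv \<alpha> \<phi> x) / ?w) \<le> E_norm \<tau> \<sigma> h K \<phi>"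
      unfolding E_norm_def by (rule SUP_upper2[OF UNIV_I[of \<alpha>]], rule SUP_upper[OF that])
    then have "ennreal (norm (multi_deriv \<alpha> \<phi> x) / ?w) \<le> ennreal C"
      using E by (rule order_trans)
    then have "norm (multi_deriv \<alpha> \<phi> x) / ?w \<le> C"
      by (simp add: C_def ennreal_le_iff)
    then show ?thesis
      using w by (simp add: divide_le_eq)
  qed
  moreover have "C \<ge> 1" by (simp add: C_def)
  ultimately show thesis by (rule that[rotated])
qed

lemma E_norm_finiteI:
  assumes "h > 0" "\<And>\<alpha> x. x \<in> K \<Longrightarrow> norm (multi_deriv \<alpha> \<phi> x) \<le>
    C * (h powr (real (multi_order \<alpha>) powr \<sigma>) * weight_seq \<tau> \<sigma> (multi_order \<alpha>))"
  shows "E_norm \<tau> \<sigma> h K \<phi> < \<infinity>"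
proof -
  have "E_norm \<tau> \<sigma> h K \<phi> \<le> ennreal C"
    unfolding E_norm_def
  proof (intro SUP_least ennreal_leI)
    fix \<alpha> :: "'a \<Rightarrow> nat" and x assume "x \<in> K"
    from assms(2)[OF this, of \<alpha>] show "norm (multi_deriv \<alpha> \<phi> x) /
        (h powr (real (multi_order \<alpha>) powr \<sigma>) * weight_seq \<tau> \<sigma> (multi_order \<alpha>)) \<le> C"
      using assms(1) by (simp add: divide_le_eq weight_seq_pos)
  qed
  then show ?thesis
    using ennreal_less_top le_less_trans by (metis infinity_ennreal_def)
qed

text \<open>Serves the Roumieu case, where \<open>f\<close> and \<open>g\<close> come with different
  parameters and must be given a common one.\<close>

lemma E_norm_mono:
  assumes "E_norm \<tau> \<sigma> h K \<phi> < \<infinity>" "0 < h" "h \<le> h'"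
  shows "E_norm \<tau> \<sigma> h' K \<phi> < \<infinity>"
proof -
  obtain C where C: "C \<ge> 1" "\<And>\<alpha> x. x \<in> K \<Longrightarrow> norm (multi_deriv \<alpha> \<phi> x) \<le>
      C * (h powr (real (multi_order \<alpha>) powr \<sigma>) * weight_seq \<tau> \<sigma> (multi_order \<alpha>))"
    using E_norm_finiteD[OF assms(1,2)] by blast
  show ?thesis
  proof (rule E_norm_finiteI)
    fix \<alpha> :: "'a \<Rightarrow> nat" and x assume "x \<in> K"
    have "C * (h powr (real (multi_order \<alpha>) powr \<sigma>) * weight_seq \<tau> \<sigma> (multi_order \<alpha>))
        \<le> C * (h' powr (real (multi_order \<alpha>) powr \<sigma>) * weight_seq \<tau> \<sigma> (multi_order \<alpha>))"
      using assms C(1) weight_seq_pos[THEN less_imp_le]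
      by (intro mult_left_mono mult_right_mono powr_mono2) auto
    with C(2)[OF \<open>x \<in> K\<close>] show "norm (multi_deriv \<alpha> \<phi> x) \<le>
        C * (h' powr (real (multi_order \<alpha>) powr \<sigma>) * weight_seq \<tau> \<sigma> (multi_order \<alpha>))"
      by (rule order_trans)
  qed (use assms in simp)
qed

lemma E_norm_compose:
  fixes f :: "real \<Rightarrow> complex" and g :: "'a::euclidean_space \<Rightarrow> real"
  assumes "\<tau> > 0" "\<sigma> > 1" "open V" "g ` V \<subseteq> U" "K \<subseteq> V" "h > 0"
    and smooth: "smooth_on U f" "smooth_on V (\<lambda>x. complex_of_real (g x))"
    and fin: "E_norm \<tau> \<sigma> h (g ` K) f < \<infinity>" "E_norm \<tau> \<sigma> h K (\<lambda>x. complex_of_real (g x)) < \<infinity>"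
  shows "E_norm \<tau> \<sigma> (exp 1 * h) K (f \<circ> g) < \<infinity>"
proof -
  let ?G = "\<lambda>x. complex_of_real (g x)"
  let ?w = "\<lambda>p. h powr (real p powr \<sigma>) * weight_seq \<tau> \<sigma> p"
  obtain C1 where C1: "C1 \<ge> 1" "\<And>\<alpha> y. y \<in> g ` K \<Longrightarrow> norm (multi_deriv \<alpha> f y) \<le> C1 * ?w (multi_order \<alpha>)"
    using E_norm_finiteD[OF fin(1) assms(6)] by blast
  obtain C2 where C2: "C2 \<ge> 1" "\<And>\<alpha> x. x \<in> K \<Longrightarrow> norm (multi_deriv \<alpha> ?G x) \<le> C2 * ?w (multi_order \<alpha>)"
    using E_norm_finiteD[OF fin(2) assms(6)] by blast
  define C where "C = max C1 C2"
  have C: "C \<ge> 1" "C1 \<le> C" "C2 \<le> C"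
    using C1 by (auto simp: C_def)
  have w: "?w p \<ge> 0" for p
    using weight_seq_pos[THEN less_imp_le] by simp
  have F: "norm (iter_deriv (replicate k 1) f (g x)) \<le> C * ?w k" if "x \<in> K" for k x
  proof -
    have "norm (iter_deriv (replicate k 1) f (g x)) \<le> C1 * ?w k"
      \<comment> \<open>On the line a multi-index has a single relevant value, so the constant
        function k yields the k-th derivative.\<close>
      using C1(2)[of "g x" "\<lambda>_. k"] that
      by (simp add: multi_deriv_eq multi_order_def basis_enum_real multi_list_def)
    also have "\<dots> \<le> C * ?w k"
      using C(2) w by (rule mult_right_mono)
    finally show ?thesis .
  qed
  have G: "norm (iter_deriv l ?G x) \<le> C * ?w (length l)"
    if "x \<in> K" and sub: "subseq l (multi_list basis_enum \<alpha>)" for l x \<alpha>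
  proof -
    obtain \<beta> where l: "l = multi_list basis_enum \<beta>"
      using subseq_multi_list[OF sub basis_enum(1)] by blast
    have "norm (iter_deriv l ?G x) \<le> C2 * ?w (length l)"
      using C2(2)[OF that(1), of \<beta>] by (simp add: multi_deriv_eq l length_multi_list)
    also have "\<dots> \<le> C * ?w (length l)"
      using C(3) w by (rule mult_right_mono)
    finally show ?thesis .
  qed
  obtain C' where C': "C' \<ge> 1" "\<And>n. n \<ge> 1 \<Longrightarrow>
      fact n * C ^ (n + 1) * max 1 ((h * real n powr \<tau>) powr (real n powr \<sigma> + n))
        \<le> C' * ((exp 1 * h) powr (real n powr \<sigma>) * weight_seq \<tau> \<sigma> n)"
    using weight_estimate[OF assms(1,2,6) C(1)] by blast
  show ?thesis
  proof (rule E_norm_finiteI)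
    fix \<alpha> :: "'a \<Rightarrow> nat" and x assume x: "x \<in> K"
    define bs where "bs = multi_list (basis_enum :: 'a list) \<alpha>"
    define n where "n = length bs"
    have n: "multi_order \<alpha> = n"
      by (simp add: n_def bs_def length_multi_list)
    \<comment> \<open>The constant \<open>C * C'\<close> serves both cases: \<open>C\<close> bounds
      order 0, which \<open>weight_estimate\<close> does not cover, and \<open>C'\<close> all higher
      orders.\<close>
    show "norm (multi_deriv \<alpha> (f \<circ> g) x) \<le> (C * C') *
        ((exp 1 * h) powr (real (multi_order \<alpha>) powr \<sigma>) * weight_seq \<tau> \<sigma> (multi_order \<alpha>))"
    proof (cases "n = 0")
      case True
      have "norm (f (g x)) \<le> C"
        using F[OF x, of 0] assms(6) by (simp add: weight_seq_def)
      also have "\<dots> \<le> C * C'"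
        using C C' by simp
      finally show ?thesis
        using True assms(6) by (simp add: n multi_deriv_eq n_def weight_seq_def flip: bs_def)
    next
      case False
      define A where "A = h * real n powr \<tau>"
      let ?T = "real n powr \<sigma> + n"
      have A: "A > 0" using assms(6) False by (simp add: A_def)
      have wA: "?w p \<le> A powr (real p powr \<sigma>)" if "1 \<le> p" "p \<le> n" for p
        unfolding A_def using weight_seq_le[OF assms(1,6) that] .
      have "norm (iter_deriv (replicate (length ls) 1) f (g x) * (\<Prod>l\<leftarrow>ls. iter_deriv l ?G x))
          \<le> C ^ (n + 1) * max 1 (A powr ?T)" if ls: "ls \<in> set (list_partitions bs)" for ls
      proof -
        let ?k = "length ls" and ?P = "\<Sum>l\<leftarrow>ls. real (length l) powr \<sigma>"
        have k: "1 \<le> ?k" "?k \<le> n"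
          using list_partitions_sum_length[OF ls] False list_partitions_length[OF ls]
          by (auto simp: n_def Suc_le_eq)
        have "norm (iter_deriv l ?G x) \<le> C * A powr (real (length l) powr \<sigma>)" if "l \<in> set ls" for l
        proof -
          note bl = list_partitions_blocks[OF ls that]
          have "?w (length l) \<le> A powr (real (length l) powr \<sigma>)"
            using bl list_emb_length[of "(=)" l bs] by (intro wA) (auto simp: n_def Suc_le_eq)
          then show ?thesis
            using G[OF x, of l \<alpha>] bl C(1) unfolding bs_def
            by (meson mult_left_mono order_trans zero_le_one)
        qed
        then have prod: "norm (\<Prod>l\<leftarrow>ls. iter_deriv l ?G x) \<le> C ^ ?k * A powr ?P"
          using C(1) A by (intro norm_prod_list_le) auto
        have "norm (iter_deriv (replicate ?k 1) f (g x)) \<le> C * A powr (real ?k powr \<sigma>)"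
          using F[OF x, of ?k] wA[OF k] C(1)
          by (meson mult_left_mono order_trans zero_le_one)
        then have "norm (iter_deriv (replicate ?k 1) f (g x) * (\<Prod>l\<leftarrow>ls. iter_deriv l ?G x))
            \<le> (C * A powr (real ?k powr \<sigma>)) * (C ^ ?k * A powr ?P)"
          unfolding norm_mult using prod C(1) by (intro mult_mono) auto
        also have "\<dots> = C ^ (?k + 1) * A powr (real ?k powr \<sigma> + ?P)"
          by (simp add: powr_add mult_ac)
        also have "\<dots> \<le> C ^ (n + 1) * max 1 (A powr ?T)"
        proof (intro mult_mono)
          show "C ^ (?k + 1) \<le> C ^ (n + 1)"
            using C(1) k by (intro power_increasing) auto
          have P: "0 \<le> ?P"
            by (intro sum_list_nonneg) auto
          show "A powr (real ?k powr \<sigma> + ?P) \<le> max 1 (A powr ?T)"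
          \<comment> \<open>For \<open>A \<ge> 1\<close> the exponent may be raised to
            \<open>?T\<close>; for \<open>A < 1\<close> its nonnegativity bounds the power by 1.
            This is where the maximum with 1 comes from.\<close>
          proof (cases "A \<ge> 1")
            case True
            have "real ?k powr \<sigma> + ?P \<le> ?T"
              using list_partitions_powr_le[OF ls, of \<sigma>] assms(2) False by (auto simp: n_def)
            with True show ?thesis
              by (intro max.coboundedI2 powr_mono)
          next
            case False
            then have "A powr (real ?k powr \<sigma> + ?P) \<le> 1 powr (real ?k powr \<sigma> + ?P)"
              using A P by (intro powr_mono2) auto
            then show ?thesis by simp
          qed
        qed (use C(1) in auto)
        finally show ?thesis .
      qed
      note term_le = this
      have "multi_deriv \<alpha> (f \<circ> g) x = (\<Sum>ls\<leftarrow>list_partitions bs.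
          iter_deriv (replicate (length ls) 1) f (g x) * (\<Prod>l\<leftarrow>ls. iter_deriv l ?G x))"
        unfolding multi_deriv_eq bs_def
        using x assms(5) by (intro iter_deriv_compose(1)[OF smooth assms(3,4) set_multi_list]) auto
      then have "norm (multi_deriv \<alpha> (f \<circ> g) x)
          \<le> length (list_partitions bs) * (C ^ (n + 1) * max 1 (A powr ?T))"
        using norm_sum_list_le[OF term_le] by simp
      also have "\<dots> \<le> fact n * (C ^ (n + 1) * max 1 (A powr ?T))"
      proof (rule mult_right_mono)
        show "real (length (list_partitions bs)) \<le> fact n"
          using length_list_partitions[of bs] by (metis n_def of_nat_fact of_nat_le_iff)
      qed (use C(1) in simp)
      also have "\<dots> = fact n * C ^ (n + 1) * max 1 ((h * real n powr \<tau>) powr ?T)"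
        by (simp add: A_def)
      also have "\<dots> \<le> C' * ((exp 1 * h) powr (real n powr \<sigma>) * weight_seq \<tau> \<sigma> n)"
        using False by (intro C'(2)) simp
      also have "\<dots> \<le> (C * C') * ((exp 1 * h) powr (real n powr \<sigma>) * weight_seq \<tau> \<sigma> n)"
        using C(1) C'(1) weight_seq_pos[of \<tau> \<sigma> n] by (intro mult_right_mono) auto
      finally show ?thesis by (simp add: n)
    qed
  qed (use assms(6) in simp)
qed

section \<open>The Roumieu and Beurling cases\<close>

theorem theorem2p2:
  fixes \<tau> \<sigma> :: real
    and U :: "real set" and V :: "(real ^ 'd) set"
    and f :: "real \<Rightarrow> complex" and g :: "real ^ 'd \<Rightarrow> real"
  assumes "\<tau> > 0" and "\<sigma> > 1"
    and "open U" and "open V"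
    and "g ` V \<subseteq> U"
  shows "(f \<in> E_Roumieu \<tau> \<sigma> U \<and> (\<lambda>x. complex_of_real (g x)) \<in> E_Roumieu \<tau> \<sigma> V
            \<longrightarrow> f \<circ> g \<in> E_Roumieu \<tau> \<sigma> V)
       \<and> (f \<in> E_Beurling \<tau> \<sigma> U \<and> (\<lambda>x. complex_of_real (g x)) \<in> E_Beurling \<tau> \<sigma> V
            \<longrightarrow> f \<circ> g \<in> E_Beurling \<tau> \<sigma> V)"
proof -
  let ?G = "\<lambda>x. complex_of_real (g x)"
  have image: "compact (g ` K) \<and> g ` K \<subseteq> U"
    if "smooth_on V ?G" "compact K" "K \<subseteq> V" for K
  proof -
    have "Ck_on 0 V ?G"
      using that(1) unfolding smooth_on_def by blast
    then have "continuous_on K (\<lambda>x. Re (?G x))"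
      using that(3) by (intro continuous_on_Re) (auto intro: continuous_on_subset)
    then show ?thesis
      using that assms(5) by (auto intro: compact_continuous_image)
  qed
  note compose = E_norm_compose[OF assms(1,2,4,5)]
  have "f \<circ> g \<in> E_Roumieu \<tau> \<sigma> V" if f: "f \<in> E_Roumieu \<tau> \<sigma> U" and g: "?G \<in> E_Roumieu \<tau> \<sigma> V"
  proof -
    have smooth: "smooth_on U f" "smooth_on V ?G"
      using f g by (auto simp: E_Roumieu_def)
    have "\<exists>h>0. E_norm \<tau> \<sigma> h K (f \<circ> g) < \<infinity>" if K: "compact K" "K \<subseteq> V" for K
    proof -
      obtain h1 where h1: "h1 > 0" "E_norm \<tau> \<sigma> h1 (g ` K) f < \<infinity>"
        using f image[OF smooth(2) K] unfolding E_Roumieu_def by blast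
      obtain h2 where h2: "h2 > 0" "E_norm \<tau> \<sigma> h2 K ?G < \<infinity>"
        using g K unfolding E_Roumieu_def by blast
      \<comment> \<open>The larger of the two parameters is admissible for both functions by
        monotonicity.\<close>
      have "E_norm \<tau> \<sigma> (exp 1 * max h1 h2) K (f \<circ> g) < \<infinity>"
        using h1 h2 by (intro compose[OF K(2) _ smooth] E_norm_mono[OF h1(2)] E_norm_mono[OF h2(2)]) auto
      then show ?thesis
        using h1(1) by (intro exI[of _ "exp 1 * max h1 h2"]) auto
    qed
    then show ?thesis
      using smooth_on_compose[OF smooth assms(4,5)] by (simp add: E_Roumieu_def)
  qed
  moreover
  have "f \<circ> g \<in> E_Beurling \<tau> \<sigma> V" if f: "f \<in> E_Beurling \<tau> \<sigma> U" and g: "?G \<in> E_Beurling \<tau> \<sigma> V"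
  proof -
    have smooth: "smooth_on U f" "smooth_on V ?G"
      using f g by (auto simp: E_Beurling_def)
    have "E_norm \<tau> \<sigma> h K (f \<circ> g) < \<infinity>" if K: "compact K" "K \<subseteq> V" and h: "h > 0" for K h
    proof -
      \<comment> \<open>Starting from \<open>h / exp 1\<close>, the loss of a factor
        \<open>exp 1\<close> leads exactly to the prescribed \<open>h\<close>.\<close>
      have h': "h / exp 1 > 0" using h by simp
      have "E_norm \<tau> \<sigma> (h / exp 1) (g ` K) f < \<infinity>" "E_norm \<tau> \<sigma> (h / exp 1) K ?G < \<infinity>"
        using f g image[OF smooth(2) K] K h' unfolding E_Beurling_def by blast+
      from compose[OF K(2) h' smooth this] show ?thesis by simp
    qed
    then show ?thesis
      using smooth_on_compose[OF smooth assms(4,5)] by (simp add: E_Beurling_def)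
  qed
  ultimately show ?thesis by blast
qed

end
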